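(* Let $G$ be a finite (not necessarily planar) weighted graph with four distinct vertices $v_1,v_2,v_3,v_4$ and six edges $v_1v_2$, $v_2v_3$, $v_3v_4$, $v_4v_1$, $v_2v_4$, $v_1v_3$ of positive weights $a,b,c,d,e,f$ respectively. Put $\Delta^*=ac+bd+ef$. Let $G'$ be obtained from $G$ by a cross move: delete these six edges and add four new vertices $u_1,u_2,u_3,u_4$, four edges $u_iv_i$ ($1\le i\le4$) of weight $1$, and six edges $u_3u_4$, $u_4u_1$, $u_1u_2$, $u_2u_3$, $u_1u_3$, $u_2u_4$ of weights $\frac a{\Delta^*},\frac b{\Delta^*},\frac c{\Delta^*},\frac d{\Delta^*},\frac e{\Delta^*},\frac f{\Delta^*}$ respectively. Then $$Z(G')=\frac1{\Delta^*}Z(G).$$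
   Context: A dimer cover (perfect matching) of a finite graph $G$ is a set $M$ of edges such that each vertex is incident to exactly one edge of $M$. Given edge weights $\mathrm{wt}$, the dimer partition function is $Z(G)=\sum_{M}\prod_{e\in M}\mathrm{wt}(e)$, summed over all dimer covers $M$ of $G$. The vertices $v_1,\dots,v_4$ may be connected arbitrarily to the rest of the graph, which is unchanged by the move. *)

theory Defs imports Complex_Main begin

text \<open>Finite weighted undirected graphs without loops. Edges carry names of their own, so that
  parallel edges are permitted; a simple graph is the case where \<open>ends\<close> is injective on the edges.\<close>

record ('v, 'e) wgraph =
  verts :: "'v set"
  edges :: "'e set"
  ends :: "'e \<Rightarrow> 'v set"
  wt :: "'e \<Rightarrow> real"

definition finite_wgraph :: "('v, 'e) wgraph \<Rightarrow> bool" where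
  "finite_wgraph G \<longleftrightarrow> finite (verts G) \<and> finite (edges G) \<and>
     (\<forall>x\<in>edges G. ends G x \<subseteq> verts G \<and> card (ends G x) = 2)"

definition dimer_cover :: "('v, 'e) wgraph \<Rightarrow> 'e set \<Rightarrow> bool" where
  "dimer_cover G M \<longleftrightarrow> M \<subseteq> edges G \<and> (\<forall>v\<in>verts G. \<exists>!x. x \<in> M \<and> v \<in> ends G x)"

definition dimer_Z :: "('v, 'e) wgraph \<Rightarrow> real" where
  "dimer_Z G = (\<Sum>M | dimer_cover G M. \<Prod>x\<in>M. wt G x)"

datatype new_vertex = U1 | U2 | U3 | U4

datatype new_edge = UV1 | UV2 | UV3 | UV4
  | UU34 | UU41 | UU12 | UU23 | UU13 | UU24

primrec new_ends :: "'v \<Rightarrow> 'v \<Rightarrow> 'v \<Rightarrow> 'v \<Rightarrow> new_edge \<Rightarrow> ('v + new_vertex) set" where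
  "new_ends v1 v2 v3 v4 UV1 = {Inr U1, Inl v1}"
| "new_ends v1 v2 v3 v4 UV2 = {Inr U2, Inl v2}"
| "new_ends v1 v2 v3 v4 UV3 = {Inr U3, Inl v3}"
| "new_ends v1 v2 v3 v4 UV4 = {Inr U4, Inl v4}"
| "new_ends v1 v2 v3 v4 UU34 = {Inr U3, Inr U4}"
| "new_ends v1 v2 v3 v4 UU41 = {Inr U4, Inr U1}"
| "new_ends v1 v2 v3 v4 UU12 = {Inr U1, Inr U2}"
| "new_ends v1 v2 v3 v4 UU23 = {Inr U2, Inr U3}"
| "new_ends v1 v2 v3 v4 UU13 = {Inr U1, Inr U3}"
| "new_ends v1 v2 v3 v4 UU24 = {Inr U2, Inr U4}"

definition cross_delta :: "real \<Rightarrow> real \<Rightarrow> real \<Rightarrow> real \<Rightarrow> real \<Rightarrow> real \<Rightarrow> real" where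
  "cross_delta a b c d e f = a * c + b * d + e * f"

primrec new_wt :: "real \<Rightarrow> real \<Rightarrow> real \<Rightarrow> real \<Rightarrow> real \<Rightarrow> real \<Rightarrow> new_edge \<Rightarrow> real" where
  "new_wt a b c d e f UV1 = 1"
| "new_wt a b c d e f UV2 = 1"
| "new_wt a b c d e f UV3 = 1"
| "new_wt a b c d e f UV4 = 1"
| "new_wt a b c d e f UU34 = a / cross_delta a b c d e f"
| "new_wt a b c d e f UU41 = b / cross_delta a b c d e f"
| "new_wt a b c d e f UU12 = c / cross_delta a b c d e f"
| "new_wt a b c d e f UU23 = d / cross_delta a b c d e f"
| "new_wt a b c d e f UU13 = e / cross_delta a b c d e f"
| "new_wt a b c d e f UU24 = f / cross_delta a b c d e f"

text \<open>The arguments \<open>x12, x23, x34, x41, x24, x13\<close> are the six edges to be deleted, \<open>xij\<close> joining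
  \<open>vi\<close> and \<open>vj\<close>. Disjoint sums make the new vertices and edges distinct from the old ones.\<close>

definition cross_move ::
  "('v, 'e) wgraph \<Rightarrow> 'v \<Rightarrow> 'v \<Rightarrow> 'v \<Rightarrow> 'v \<Rightarrow> 'e \<Rightarrow> 'e \<Rightarrow> 'e \<Rightarrow> 'e \<Rightarrow> 'e \<Rightarrow> 'e \<Rightarrow>
   ('v + new_vertex, 'e + new_edge) wgraph" where
  "cross_move G v1 v2 v3 v4 x12 x23 x34 x41 x24 x13 =
     \<lparr>verts = verts G <+> UNIV,
      edges = (edges G - {x12, x23, x34, x41, x24, x13}) <+> UNIV,
      ends = case_sum (\<lambda>x. Inl ` ends G x) (new_ends v1 v2 v3 v4),
      wt = case_sum (wt G)
             (new_wt (wt G x12) (wt G x23) (wt G x34) (wt G x41) (wt G x24) (wt G x13))\<rparr>"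

end

theory Submission imports Defs "HOL-Library.Disjoint_Sets" begin

text \<open>
  Let \<open>E\<close> be the set of edges that the cross move leaves alone, and for a subset \<open>S\<close> of
  \<open>{v\<^sub>1, v\<^sub>2, v\<^sub>3, v\<^sub>4}\<close> let \<open>K(S)\<close> be the dimer partition function of the graph with edge
  set \<open>E\<close> and vertex set \<open>V - S\<close>. Fixing which of the modified edges a dimer cover uses
  writes either partition function as a linear combination of the eight numbers \<open>K(S)\<close> with
  \<open>S\<close> of even size.

  In \<open>G\<close> the modified edges form a complete graph on the \<open>v\<^sub>i\<close>, and \<open>K(S)\<close> is multiplied by
  the partition function of the complete graph on \<open>S\<close>: this is \<open>1\<close> for the empty set, the
  weight of the edge \<open>v\<^sub>iv\<^sub>j\<close> for a pair, and \<open>\<Delta>\<^sup>* = ac + bd + ef\<close> for all four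
  vertices (\<open>cover_sum_K4\<close>).

  In \<open>G'\<close> the set \<open>S\<close> consists of those \<open>v\<^sub>i\<close> that are matched along the pendant edge
  \<open>u\<^sub>iv\<^sub>i\<close>, so the other \<open>u\<^sub>j\<close> must be matched among themselves: the coefficient of \<open>K(S)\<close> is
  the partition function of the complete graph on the \<open>u\<^sub>j\<close> with \<open>v\<^sub>j\<close> outside \<open>S\<close>
  (\<open>cover_sum_pendant_K4\<close>). The new weights are the old ones divided by \<open>\<Delta>\<^sup>*\<close> and moved to
  the opposite edge. Hence a pair gets its old coefficient divided by \<open>\<Delta>\<^sup>*\<close>, the empty set gets
  \<open>\<Delta>\<^sup>* / (\<Delta>\<^sup>*)\<^sup>2 = 1 / \<Delta>\<^sup>*\<close>, and the full set gets \<open>1 = \<Delta>\<^sup>* / \<Delta>\<^sup>*\<close>. Every coefficient has been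
  divided by \<open>\<Delta>\<^sup>*\<close>.

  Both expansions come from one recursion, \<open>cover_sum_insert\<close>, which removes a single edge.
\<close>

text \<open>Unlike a dimer cover, an exact cover is not tied to a graph: the vertex set to be covered
  varies while the edges stay fixed, and edges that stick out of it are simply never used. This
  is what a recursion that removes matched vertices needs.\<close>

definition exact_cover :: "('e \<Rightarrow> 'v set) \<Rightarrow> 'e set \<Rightarrow> 'v set \<Rightarrow> bool" where
  "exact_cover N M W \<longleftrightarrow> disjoint_family_on N M \<and> \<Union> (N ` M) = W"

definition cover_sum ::
  "('e \<Rightarrow> 'v set) \<Rightarrow> ('e \<Rightarrow> 'r::comm_semiring_1) \<Rightarrow> 'e set \<Rightarrow> 'v set \<Rightarrow> 'r" where
  "cover_sum N w E W = (\<Sum>M | M \<subseteq> E \<and> exact_cover N M W. prod w M)"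

lemma dimer_cover_iff_exact_cover:
  assumes "\<And>x. x \<in> edges G \<Longrightarrow> ends G x \<subseteq> verts G"
  shows "dimer_cover G M \<longleftrightarrow> M \<subseteq> edges G \<and> exact_cover (ends G) M (verts G)"
proof (cases "M \<subseteq> edges G")
  case True
  then have "\<Union> (ends G ` M) \<subseteq> verts G"
    using assms by blast
  with True show ?thesis
    unfolding dimer_cover_def exact_cover_def disjoint_family_on_def by blast
qed (simp add: dimer_cover_def)

lemma dimer_Z_eq_cover_sum:
  assumes "\<And>x. x \<in> edges G \<Longrightarrow> ends G x \<subseteq> verts G"
  shows "dimer_Z G = cover_sum (ends G) (wt G) (edges G) (verts G)"
  by (simp add: dimer_Z_def cover_sum_def dimer_cover_iff_exact_cover[OF assms])

lemma exact_cover_insert: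
  assumes "x \<notin> M"
  shows "exact_cover N (insert x M) W \<longleftrightarrow> N x \<subseteq> W \<and> exact_cover N M (W - N x)"
  using assms by (auto simp: exact_cover_def disjoint_family_on_insert)

text \<open>Deletion of an edge: either a cover avoids \<open>x\<close>, or removing \<open>x\<close> from it leaves an exact
  cover of the vertices that are not ends of \<open>x\<close>.\<close>

lemma cover_sum_insert:
  assumes "finite E" "x \<notin> E"
  shows "cover_sum N w (insert x E) W =
    cover_sum N w E W + (if N x \<subseteq> W then w x * cover_sum N w E (W - N x) else 0)"
proof -
  let ?C = "\<lambda>W. {M. M \<subseteq> E \<and> exact_cover N M W}"
  let ?D = "{M. M \<subseteq> E \<and> exact_cover N (insert x M) W}"
  have fin: "finite (?C W)" "finite ?D"
    using assms(1) by auto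
  have split: "{M. M \<subseteq> insert x E \<and> exact_cover N M W} = ?C W \<union> insert x ` ?D"
    unfolding Pow_iff[symmetric] Pow_insert by blast
  have inj: "inj_on (insert x) ?D"
    using assms(2) by (auto simp: inj_on_def)
  have "cover_sum N w (insert x E) W = cover_sum N w E W + (\<Sum>M\<in>insert x ` ?D. prod w M)"
    unfolding cover_sum_def split using fin assms(2) by (intro sum.union_disjoint) auto
  also have "(\<Sum>M\<in>insert x ` ?D. prod w M) = (\<Sum>M\<in>?D. w x * prod w M)"
    unfolding sum.reindex[OF inj] comp_def using assms
    by (intro sum.cong refl prod.insert) (auto intro: finite_subset)
  also have "?D = (if N x \<subseteq> W then ?C (W - N x) else {})"
  proof -
    have "x \<notin> M" if "M \<subseteq> E" for M
      using that assms(2) by blast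
    then show ?thesis
      by (simp add: exact_cover_insert cong: conj_cong)
  qed
  finally show ?thesis
    by (simp add: cover_sum_def sum_distrib_left)
qed

lemma cover_sum_eq_0:
  assumes "v \<in> W" "\<And>x. x \<in> E \<Longrightarrow> v \<notin> N x"
  shows "cover_sum N w E W = 0"
proof -
  have "{M. M \<subseteq> E \<and> exact_cover N M W} = {}"
    using assms unfolding exact_cover_def by blast
  then show ?thesis
    by (simp only: cover_sum_def sum.empty)
qed

text \<open>After the cross move the unchanged part of the graph is a copy under \<^const>\<open>Inl\<close>; the next
  two lemmas transport its covers back.\<close>

lemma exact_cover_inj_image:
  assumes "inj g" "inj h" "\<And>x. x \<in> M \<Longrightarrow> N' (h x) = g ` N x"
  shows "exact_cover N' (h ` M) (g ` W) \<longleftrightarrow> exact_cover N M W"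
proof -
  have "\<Union> (N' ` h ` M) = g ` \<Union> (N ` M)"
    using assms(3) by auto
  then have "\<Union> (N' ` h ` M) = g ` W \<longleftrightarrow> \<Union> (N ` M) = W"
    by (simp add: inj_image_eq_iff[OF assms(1)])
  moreover have "disjoint_family_on N' (h ` M) \<longleftrightarrow> disjoint_family_on N M"
    unfolding disjoint_family_on_def
    by (simp add: assms(3) inj_eq[OF assms(2)] flip: image_Int[OF assms(1)])
  ultimately show ?thesis
    by (simp add: exact_cover_def)
qed

lemma cover_sum_inj_image:
  assumes "inj g" "inj h" "\<And>x. x \<in> E \<Longrightarrow> N' (h x) = g ` N x"
    and "\<And>x. x \<in> E \<Longrightarrow> w' (h x) = w x"
  shows "cover_sum N' w' (h ` E) (g ` W) = cover_sum N w E W"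
proof -
  have eq: "{M. M \<subseteq> h ` E \<and> exact_cover N' M (g ` W)}
      = image h ` {M. M \<subseteq> E \<and> exact_cover N M W}"
  proof -
    have "{M. M \<subseteq> h ` E \<and> exact_cover N' M (g ` W)}
        = image h ` {M. M \<subseteq> E \<and> exact_cover N' (h ` M) (g ` W)}"
      by (auto simp: subset_image_iff)
    also have "{M. M \<subseteq> E \<and> exact_cover N' (h ` M) (g ` W)} = {M. M \<subseteq> E \<and> exact_cover N M W}"
      by (intro Collect_cong conj_cong refl exact_cover_inj_image assms) (use assms(3) in blast)
    finally show ?thesis .
  qed
  have "inj_on (image h) {M. M \<subseteq> E \<and> exact_cover N M W}"
    using assms(2) by (simp add: inj_on_def inj_image_eq_iff)
  then have "cover_sum N' w' (h ` E) (g ` W)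
      = (\<Sum>M | M \<subseteq> E \<and> exact_cover N M W. prod w' (h ` M))"
    by (simp add: cover_sum_def eq sum.reindex)
  also have "\<dots> = cover_sum N w E W"
    unfolding cover_sum_def
  proof (rule sum.cong[OF refl])
    fix M assume M: "M \<in> {M. M \<subseteq> E \<and> exact_cover N M W}"
    have "prod w' (h ` M) = prod (w' \<circ> h) M"
      using assms(2) by (intro prod.reindex) (simp add: inj_on_def)
    also have "\<dots> = prod w M"
      using M assms(4) by (intro prod.cong) auto
    finally show "prod w' (h ` M) = prod w M" .
  qed
  finally show ?thesis .
qed

lemma Diff_Diff: "A - B - C = A - (B \<union> C)"
  by blast

text \<open>The terms correspond to the ten matchings of the complete graph on four vertices: the empty
  one, six single edges, and three perfect matchings, which all leave the same vertices to \<open>E\<close>.\<close>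

lemma cover_sum_K4:
  fixes N :: "'e \<Rightarrow> 'v set" and w :: "'e \<Rightarrow> 'r::comm_semiring_1"
  assumes "finite E" "distinct [v1, v2, v3, v4]" "{v1, v2, v3, v4} \<subseteq> W"
    and x: "N x12 = {v1, v2}" "N x23 = {v2, v3}" "N x34 = {v3, v4}"
      "N x41 = {v4, v1}" "N x24 = {v2, v4}" "N x13 = {v1, v3}"
    and "{x12, x23, x34, x41, x24, x13} \<inter> E = {}"
  shows "cover_sum N w ({x12, x23, x34, x41, x24, x13} \<union> E) W =
    cover_sum N w E W
    + w x12 * cover_sum N w E (W - {v1, v2}) + w x23 * cover_sum N w E (W - {v2, v3})
    + w x34 * cover_sum N w E (W - {v3, v4}) + w x41 * cover_sum N w E (W - {v4, v1})
    + w x24 * cover_sum N w E (W - {v2, v4}) + w x13 * cover_sum N w E (W - {v1, v3})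
    + (w x12 * w x34 + w x23 * w x41 + w x24 * w x13) * cover_sum N w E (W - {v1, v2, v3, v4})"
proof -
  \<comment> \<open>Edges with different ends differ, so each of the six can be removed in turn.\<close>
  have "distinct [{v1, v2}, {v2, v3}, {v3, v4}, {v4, v1}, {v2, v4}, {v1, v3}]"
    using assms(2) by (auto simp: doubleton_eq_iff)
  then have "distinct [x12, x23, x34, x41, x24, x13]"
    using distinct_map[of N "[x12, x23, x34, x41, x24, x13]"] by (simp add: x)
  \<comment> \<open>The reversed list provides the inequalities in the other orientation.\<close>
  moreover have "distinct (rev [v1, v2, v3, v4])"
    using assms(2) unfolding distinct_rev .
  ultimately show ?thesis
    using assms
    by (simp add: cover_sum_insert Diff_Diff) (simp add: algebra_simps insert_commute)
qed

text \<open>Removing the ten new edges gives one term for each matching that they contain. A matching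
  that misses some \<open>u\<^sub>i\<close> contributes \<open>0\<close>, because the remaining edges do not reach \<open>u\<^sub>i\<close>. The
  others are determined by their edges among the \<open>u\<^sub>i\<close>, all further \<open>u\<^sub>i\<close> being matched to
  \<open>v\<^sub>i\<close>; this is why the edge \<open>u\<^sub>3u\<^sub>4\<close> goes with the removal of \<open>v\<^sub>1, v\<^sub>2\<close>, and so on.\<close>

lemma cover_sum_pendant_K4:
  fixes N :: "'e \<Rightarrow> 'v set" and w :: "'e + new_edge \<Rightarrow> 'r::comm_semiring_1"
  assumes "finite E" "distinct [v1, v2, v3, v4]" "{v1, v2, v3, v4} \<subseteq> W"
    and w1: "w (Inr UV1) = 1" "w (Inr UV2) = 1" "w (Inr UV3) = 1" "w (Inr UV4) = 1"
  shows "cover_sum (case_sum (\<lambda>x. Inl ` N x) (new_ends v1 v2 v3 v4)) w (E <+> UNIV) (W <+> UNIV) =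
    (w (Inr UU12) * w (Inr UU34) + w (Inr UU23) * w (Inr UU41) + w (Inr UU24) * w (Inr UU13))
      * cover_sum N (w \<circ> Inl) E W
    + w (Inr UU34) * cover_sum N (w \<circ> Inl) E (W - {v1, v2})
    + w (Inr UU41) * cover_sum N (w \<circ> Inl) E (W - {v2, v3})
    + w (Inr UU12) * cover_sum N (w \<circ> Inl) E (W - {v3, v4})
    + w (Inr UU23) * cover_sum N (w \<circ> Inl) E (W - {v4, v1})
    + w (Inr UU13) * cover_sum N (w \<circ> Inl) E (W - {v2, v4})
    + w (Inr UU24) * cover_sum N (w \<circ> Inl) E (W - {v1, v3})
    + cover_sum N (w \<circ> Inl) E (W - {v1, v2, v3, v4})"
    (is "cover_sum ?N' w _ _ = _")
proof -
  have rest: "cover_sum ?N' w (Inl ` E) S =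
      (if range Inr \<inter> S = {} then cover_sum N (w \<circ> Inl) E (Inl -` S) else 0)" for S
  proof (cases "range Inr \<inter> S = {}")
    case True
    then have "S = Inl ` (Inl -` S)"
      by (auto simp: image_iff) (metis Int_iff empty_iff rangeI sum.exhaust)
    then show ?thesis
      using True cover_sum_inj_image[of Inl Inl E ?N' N w "w \<circ> Inl" "Inl -` S"]
      by simp
  next
    case False
    then obtain u where "Inr u \<in> S" by blast
    then have "cover_sum ?N' w (Inl ` E) S = 0"
      by (rule cover_sum_eq_0) auto
    with False show ?thesis by simp
  qed
  \<comment> \<open>Enumerating the new vertices and edges makes the recursion computable by rewriting.\<close>
  have vertices: "range Inr \<inter> S = {} \<longleftrightarrow>
      Inr U1 \<notin> S \<and> Inr U2 \<notin> S \<and> Inr U3 \<notin> S \<and> Inr U4 \<notin> S" for S :: "('v + new_vertex) set"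
    by (auto; metis new_vertex.exhaust)
  have edges: "E <+> UNIV = {Inr UV1, Inr UV2, Inr UV3, Inr UV4, Inr UU12, Inr UU34,
      Inr UU23, Inr UU41, Inr UU13, Inr UU24} \<union> Inl ` E"
    by (auto; metis new_edge.exhaust)
  have mem: "Inr u \<in> W <+> UNIV" "Inl v \<in> W <+> UNIV \<longleftrightarrow> v \<in> W" for u :: new_vertex and v
    by auto
  have old: "Inl -` ((W <+> UNIV) - S) = W - Inl -` S"
    "Inl -` insert (Inl v) S = insert v (Inl -` S)" "Inl -` insert (Inr u) S = Inl -` S"
    "Inl -` (W <+> (UNIV :: new_vertex set)) = W"
    for S :: "('v + new_vertex) set" and u v
    by auto
  have "distinct (rev [v1, v2, v3, v4])"
    using assms(2) unfolding distinct_rev .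
  then show ?thesis
    unfolding edges using assms
    by (simp add: cover_sum_insert Diff_Diff image_iff mem rest vertices old)
      (simp add: algebra_simps insert_commute)
qed

theorem lemma43:
  fixes G :: "('v, 'e) wgraph"
    and v1 v2 v3 v4 :: 'v
    and x12 x23 x34 x41 x24 x13 :: 'e
    and a b c d e f :: real
  assumes "finite_wgraph G"
    and "{v1, v2, v3, v4} \<subseteq> verts G" and "distinct [v1, v2, v3, v4]"
    and "{x12, x23, x34, x41, x24, x13} \<subseteq> edges G"
    and "ends G x12 = {v1, v2}" and "ends G x23 = {v2, v3}" and "ends G x34 = {v3, v4}"
    and "ends G x41 = {v4, v1}" and "ends G x24 = {v2, v4}" and "ends G x13 = {v1, v3}"
    and "wt G x12 = a" and "wt G x23 = b" and "wt G x34 = c"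
    and "wt G x41 = d" and "wt G x24 = e" and "wt G x13 = f"
    and "a > 0" and "b > 0" and "c > 0" and "d > 0" and "e > 0" and "f > 0"
  shows "dimer_Z (cross_move G v1 v2 v3 v4 x12 x23 x34 x41 x24 x13)
           = 1 / cross_delta a b c d e f * dimer_Z G"
proof -
  let ?G' = "cross_move G v1 v2 v3 v4 x12 x23 x34 x41 x24 x13"
  let ?X = "{x12, x23, x34, x41, x24, x13}"
  define \<Delta> where "\<Delta> = cross_delta a b c d e f"
  define E where "E = edges G - ?X"
  define w' where "w' = case_sum (wt G) (new_wt a b c d e f)"
  define K where "K S = cover_sum (ends G) (wt G) E (verts G - S)" for S
  have \<Delta>: "\<Delta> = a * c + b * d + f * e" "\<Delta> \<noteq> 0"
    using assms(17-22) by (simp_all add: \<Delta>_def cross_delta_def add_pos_pos less_imp_neq[symmetric])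
  have G: "finite E" "\<And>x. x \<in> edges G \<Longrightarrow> ends G x \<subseteq> verts G"
    using assms(1) by (auto simp: finite_wgraph_def E_def)
  have w_old: "w' \<circ> Inl = wt G"
    by (auto simp: w'_def)
  have "edges G = ?X \<union> E"
    using assms(4) by (auto simp: E_def)
  then have "dimer_Z G = cover_sum (ends G) (wt G) (?X \<union> E) (verts G)"
    using dimer_Z_eq_cover_sum[of G] G(2) by simp
  also have "\<dots> = K {} + a * K {v1, v2} + b * K {v2, v3} + c * K {v3, v4} + d * K {v4, v1}
      + e * K {v2, v4} + f * K {v1, v3} + \<Delta> * K {v1, v2, v3, v4}"
    by (subst cover_sum_K4[OF G(1) assms(3,2) assms(5-10)])
      (auto simp: E_def K_def assms(11-16) \<Delta>(1) algebra_simps)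
  finally have Z: "dimer_Z G = \<dots>" .
  have "ends ?G' x \<subseteq> verts ?G'" if "x \<in> edges ?G'" for x
  proof (cases x)
    case (Inl y)
    then show ?thesis
      using that G(2) by (auto simp: cross_move_def)
  next
    case (Inr y)
    then show ?thesis
      using assms(2) by (cases y) (auto simp: cross_move_def)
  qed
  then have "dimer_Z ?G' = cover_sum (case_sum (\<lambda>x. Inl ` ends G x) (new_ends v1 v2 v3 v4)) w'
      (E <+> UNIV) (verts G <+> UNIV)"
    by (subst dimer_Z_eq_cover_sum) (auto simp: cross_move_def E_def w'_def assms(11-16))
  also have "\<dots> = (c / \<Delta> * (a / \<Delta>) + d / \<Delta> * (b / \<Delta>) + f / \<Delta> * (e / \<Delta>)) * K {}
      + a / \<Delta> * K {v1, v2} + b / \<Delta> * K {v2, v3} + c / \<Delta> * K {v3, v4} + d / \<Delta> * K {v4, v1}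
      + e / \<Delta> * K {v2, v4} + f / \<Delta> * K {v1, v3} + K {v1, v2, v3, v4}"
    by (subst cover_sum_pendant_K4[OF G(1) assms(3,2)])
      (simp_all add: w_old, simp_all add: w'_def K_def \<Delta>_def)
  \<comment> \<open>The three perfect matchings on the new vertices: the only coefficient that is quadratic
    in the new weights, so that one factor of the denominator cancels.\<close>
  also have "c / \<Delta> * (a / \<Delta>) + d / \<Delta> * (b / \<Delta>) + f / \<Delta> * (e / \<Delta>) = \<Delta> / (\<Delta> * \<Delta>)"
    unfolding \<Delta>(1) by (simp add: add_divide_distrib mult.commute)
  finally show ?thesis
    using \<Delta>(2) by (simp add: Z field_simps flip: \<Delta>_def)
qed

end
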